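(* Among all cycle graphs $C_n$ ($n\ge 3$), only $C_3=K_3$ yields a binary even LCD code; that is, for $n\ge 3$, $C_n$ yields a binary even LCD code if and only if $n=3$.
   Context: $C_n$ denotes the cycle graph on $n$ vertices, and $K_3$ the complete graph on 3 vertices. A binary code of length $n$ is a linear subspace $C\subseteq\mathbb{F}_2^n$ (the zero code is allowed). Its dual $C^\perp$ is taken with respect to $\langle x,y\rangle=\sum_i x_iy_i$. $C$ is LCD (linear complementary dual) if $C\cap C^\perp=\{0\}$, equivalently $\mathbb{F}_2^n=C\oplus C^\perp$. $C$ is even if every codeword has even Hamming weight. For an LCD code $C$, the orthogonal projector $\Pi_C$ is the unique $n\times n$ matrix over $\mathbb{F}_2$ with $v\Pi_C=v$ for all row vectors $v\in C$ and $v\Pi_C=0$ for all $v\in C^\perp$. A finite simple graph on $n$ (ordered) vertices with adjacency matrix $A$ is said to yield a binary even LCD code if $A$, read over $\mathbb{F}_2$, equals $\Pi_C$ for some binary even LCD code $C$ of length $n$; this $C$ (which is the row span of $A$ over $\mathbb{F}_2$) is the code yielded by the graph. *)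

theory Defs
  imports
    Jordan_Normal_Form.VS_Connect
    Graph_Theory.Pair_Digraph
    Graph_Theory.Kuratowski
    "HOL-Library.Z2"
begin

text \<open>The field with two elements is the type \<^typ>\<open>bit\<close>. Finite simple graphs are the
  \<^const>\<open>pair_graph\<close>s: every edge is represented by both of its orientations.\<close>

definition binary_code :: "nat \<Rightarrow> bit vec set \<Rightarrow> bool" where
  "binary_code n C \<longleftrightarrow> VectorSpace.subspace class_ring C (module_vec TYPE(bit) n)"

abbreviation dual_code :: "nat \<Rightarrow> bit vec set \<Rightarrow> bit vec set" where
  "dual_code n C \<equiv> vec_module.orthogonal_complement n C"

definition LCD_code :: "nat \<Rightarrow> bit vec set \<Rightarrow> bool" where
  "LCD_code n C \<longleftrightarrow> binary_code n C \<and> C \<inter> dual_code n C = {0\<^sub>v n}"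

definition hamming_weight :: "bit vec \<Rightarrow> nat" where
  "hamming_weight v = card {i. i < dim_vec v \<and> v $ i \<noteq> 0}"

definition even_code :: "bit vec set \<Rightarrow> bool" where
  "even_code C \<longleftrightarrow> (\<forall>v\<in>C. even (hamming_weight v))"

definition row_vec_mult :: "'a vec \<Rightarrow> 'a::semiring_0 mat \<Rightarrow> 'a vec" where
  "row_vec_mult v M = vec (dim_col M) (\<lambda>j. v \<bullet> col M j)"

text \<open>The description determines a matrix only if \<open>C\<close> is LCD, since then the whole space is the
  direct sum of \<open>C\<close> and its dual.\<close>

definition orthogonal_projector :: "nat \<Rightarrow> bit vec set \<Rightarrow> bit mat" where
  "orthogonal_projector n C =
     (THE P. P \<in> carrier_mat n n
        \<and> (\<forall>v\<in>C. row_vec_mult v P = v)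
        \<and> (\<forall>v\<in>dual_code n C. row_vec_mult v P = 0\<^sub>v n))"

definition vertex_ordering :: "'a pair_pre_digraph \<Rightarrow> 'a list \<Rightarrow> bool" where
  "vertex_ordering G vs \<longleftrightarrow> distinct vs \<and> set vs = pverts G"

definition adjacency_matrix :: "'a pair_pre_digraph \<Rightarrow> 'a list \<Rightarrow> 'b::zero_neq_one mat" where
  "adjacency_matrix G vs =
     mat (length vs) (length vs) (\<lambda>(i, j). if (vs ! i, vs ! j) \<in> parcs G then 1 else 0)"

definition yields_even_LCD_code :: "'a pair_pre_digraph \<Rightarrow> 'a list \<Rightarrow> bool" where
  "yields_even_LCD_code G vs \<longleftrightarrow> pair_graph G \<and> vertex_ordering G vs
     \<and> (\<exists>C. LCD_code (length vs) C \<and> even_code C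
            \<and> adjacency_matrix G vs = orthogonal_projector (length vs) C)"

text \<open>Intended for \<open>n \<ge> 3\<close> only; for \<open>n = 1\<close> this has a loop.\<close>

definition cycle_graph :: "nat \<Rightarrow> nat pair_pre_digraph" where
  "cycle_graph n = \<lparr> pverts = {0..<n},
     parcs = {(i, j). i < n \<and> j < n \<and> (j = Suc i mod n \<or> i = Suc j mod n)} \<rparr>"

end

theory Submission
  imports Defs
begin

text \<open>
  A maximal subspace avoiding a given vector has index two, so the indicator of its complement is a
  linear functional; this separates a subspace from any vector outside it. Hence double duals are
  trivial, an LCD code and its dual span the whole space, and the orthogonal projector exists and
  is idempotent. If a cycle graph yields a code, then its adjacency matrix is idempotent over the
  field with two elements, so adjacent vertices have a common neighbour, which fails for
  \<open>n \<ge> 4\<close>. The triangle yields the code of all even weight words.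
\<close>

section \<open>Binary codes and their duals\<close>

lemma bit_add_self [simp]: "(x::bit) + x = 0"
  by (cases x) auto

lemma bit_vec_add_self:
  fixes v :: "bit vec"
  assumes "v \<in> carrier_vec n"
  shows "v + v = 0\<^sub>v n"
  using assms by (intro eq_vecI) auto

lemma bit_vec_add_eq_0D:
  fixes v w :: "bit vec"
  assumes "v + w = 0\<^sub>v n" "v \<in> carrier_vec n" "w \<in> carrier_vec n"
  shows "v = w"
proof -
  have "v = v + (w + w)" using assms by (simp add: bit_vec_add_self)
  also have "\<dots> = (v + w) + w" using assms by (intro assoc_add_vec[of _ n, symmetric])
  finally show ?thesis using assms by simp
qed

lemma dual_code_iff:
  "x \<in> dual_code n C \<longleftrightarrow> x \<in> carrier_vec n \<and> (\<forall>y\<in>C. x \<bullet> y = 0)"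
  unfolding vec_module.orthogonal_complement_def by simp

text \<open>The only scalars are 0 and 1, so closure under scalar multiplication already follows
  from containing zero.\<close>

lemma binary_code_iff:
  "binary_code n C \<longleftrightarrow>
    C \<subseteq> carrier_vec n \<and> 0\<^sub>v n \<in> C \<and> (\<forall>x\<in>C. \<forall>y\<in>C. x + y \<in> C)"
proof
  assume "binary_code n C"
  then have "submodule class_ring C (module_vec TYPE(bit) n)"
    unfolding binary_code_def VectorSpace.subspace_def by simp
  from submodule.subset[OF this] submodule.m_closed[OF this] submodule.zero_closed[OF this]
  show "C \<subseteq> carrier_vec n \<and> 0\<^sub>v n \<in> C \<and> (\<forall>x\<in>C. \<forall>y\<in>C. x + y \<in> C)"
    by (auto simp: module_vec_simps)
next
  assume C: "C \<subseteq> carrier_vec n \<and> 0\<^sub>v n \<in> C \<and> (\<forall>x\<in>C. \<forall>y\<in>C. x + y \<in> C)"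
  have smult: "c \<cdot>\<^sub>v x \<in> C" if "x \<in> C" for c and x
  proof (cases c)
    case zero
    have "c \<cdot>\<^sub>v x = 0\<^sub>v n"
      using that C zero by (intro eq_vecI) auto
    then show ?thesis using C by simp
  next
    case one
    then show ?thesis using that by simp
  qed
  interpret vec_module "TYPE(bit)" n .
  have "submodule class_ring C (module_vec TYPE(bit) n)"
  proof (rule submodule.intro)
    show "Module.module class_ring (module_vec TYPE(bit) n)"
      by (rule vec_module)
  qed (use C smult in \<open>auto simp: module_vec_simps\<close>)
  then show "binary_code n C"
    unfolding binary_code_def VectorSpace.subspace_def using vec_vs by blast
qed

lemma binary_code_dual:
  assumes "C \<subseteq> carrier_vec n"
  shows "binary_code n (dual_code n C)"
  unfolding binary_code_iff using assms
  by (auto simp: dual_code_iff subset_iff add_scalar_prod_distrib[of _ n])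

section \<open>Sums of codes\<close>

definition code_sum :: "bit vec set \<Rightarrow> bit vec set \<Rightarrow> bit vec set" where
  "code_sum C D = {c + d | c d. c \<in> C \<and> d \<in> D}"

lemma vec_add_interchange:
  fixes a b c d :: "bit vec"
  assumes "a \<in> carrier_vec n" "b \<in> carrier_vec n" "c \<in> carrier_vec n" "d \<in> carrier_vec n"
  shows "(a + b) + (c + d) = (a + c) + (b + d)"
  using assms by (intro eq_vecI) auto

lemma binary_code_sum:
  assumes "binary_code n C" "binary_code n D"
  shows "binary_code n (code_sum C D)"
  unfolding binary_code_iff
proof (intro conjI ballI)
  show "code_sum C D \<subseteq> carrier_vec n"
    using assms unfolding binary_code_iff code_sum_def by (auto intro!: add_carrier_vec)
  have "0\<^sub>v n = 0\<^sub>v n + (0\<^sub>v n :: bit vec)" by simp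
  then show "0\<^sub>v n \<in> code_sum C D"
    using assms unfolding binary_code_iff code_sum_def by blast
next
  fix x y
  assume "x \<in> code_sum C D" "y \<in> code_sum C D"
  then obtain a b c d where *: "a \<in> C" "b \<in> D" "c \<in> C" "d \<in> D" "x = a + b" "y = c + d"
    unfolding code_sum_def by blast
  moreover from * assms have "x + y = (a + c) + (b + d)"
    unfolding binary_code_iff by (auto intro: vec_add_interchange)
  ultimately show "x + y \<in> code_sum C D"
    using assms unfolding binary_code_iff code_sum_def by blast
qed

text \<open>Over the field with two elements an additive map is linear, hence determined by its
  values on the unit vectors. This serves both to represent a functional as a scalar product and to
  read off the matrix of a projection.\<close>

lemma additive_functional_expansion:
  fixes f :: "bit vec \<Rightarrow> bit"
  assumes add: "\<And>v w. v \<in> carrier_vec n \<Longrightarrow> w \<in> carrier_vec n \<Longrightarrow> f (v + w) = f v + f w"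
    and w: "w \<in> carrier_vec n"
  shows "f w = (\<Sum>i<n. w $ i * f (unit_vec n i))"
proof -
  \<comment> \<open>\<open>t k\<close> keeps the first \<open>k\<close> entries of \<open>w\<close>
    and clears the rest, so each induction step adds one multiple of a unit vector.\<close>
  define t where "t k = vec n (\<lambda>i. if i < k then w $ i else 0)" for k
  have zero: "f (0\<^sub>v n) = 0"
    using add[of "0\<^sub>v n" "0\<^sub>v n"] by simp
  have "k \<le> n \<Longrightarrow> f (t k) = (\<Sum>i<k. w $ i * f (unit_vec n i))" for k
  proof (induction k)
    case 0
    have "t 0 = 0\<^sub>v n" unfolding t_def by auto
    then show ?case using zero by simp
  next
    case (Suc k)
    have "t (Suc k) = t k + w $ k \<cdot>\<^sub>v unit_vec n k"
      unfolding t_def using Suc.prems by (intro eq_vecI) (auto simp: less_Suc_eq)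
    then have "f (t (Suc k)) = f (t k) + f (w $ k \<cdot>\<^sub>v unit_vec n k)"
      by (simp add: add t_def)
    also have "f (w $ k \<cdot>\<^sub>v unit_vec n k) = w $ k * f (unit_vec n k)"
    proof (cases "w $ k")
      case zero: zero
      have "0 \<cdot>\<^sub>v unit_vec n k = (0\<^sub>v n :: bit vec)" by auto
      then show ?thesis using \<open>f (0\<^sub>v n) = 0\<close> zero by simp
    qed auto
    finally show ?case using Suc by simp
  qed
  moreover have "t n = w" unfolding t_def using w by auto
  ultimately show ?thesis by force
qed

text \<open>Finiteness guarantees that a maximal subspace avoiding a given vector exists, with no
  appeal to dimension or to Zorn's lemma.\<close>

lemma finite_bit_vecs: "finite (carrier_vec n :: bit vec set)"
proof (rule finite_subset)
  show "carrier_vec n \<subseteq> vec_of_list ` {xs :: bit list. set xs \<subseteq> UNIV \<and> length xs = n}"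
  proof
    fix v :: "bit vec"
    assume "v \<in> carrier_vec n"
    then have "v = vec_of_list (list_of_vec v)" "length (list_of_vec v) = n"
      by (auto simp: vec_list)
    then show "v \<in> vec_of_list ` {xs. set xs \<subseteq> UNIV \<and> length xs = n}" by blast
  qed
  have "finite (UNIV :: bit set)"
  proof (rule finite_subset)
    show "(UNIV :: bit set) \<subseteq> {0, 1}" using bit.exhaust by auto
  qed simp
  then show "finite (vec_of_list ` {xs :: bit list. set xs \<subseteq> UNIV \<and> length xs = n})"
    by (intro finite_imageI finite_lists_length_eq)
qed

text \<open>A Hahn-Banach statement for codes: read contrapositively, a vector orthogonal to the
  whole dual of \<open>U\<close> lies in \<open>U\<close>.\<close>

lemma dual_code_separation:
  assumes U: "binary_code n U" and v: "v \<in> carrier_vec n" "v \<notin> U"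
  obtains x where "x \<in> dual_code n U" "x \<bullet> v = 1"
proof -
  define F where "F = {M. binary_code n M \<and> U \<subseteq> M \<and> v \<notin> M}"
  have "F \<subseteq> Pow (carrier_vec n)" unfolding F_def binary_code_iff by auto
  then have fin: "finite F" by (rule finite_subset) (simp add: finite_bit_vecs)
  have "U \<in> F" using U v by (simp add: F_def)
  with fin obtain M where M': "M \<in> F" and max': "\<forall>N\<in>F. M \<subseteq> N \<longrightarrow> M = N"
    using finite_has_maximal2[of F U] by auto
  have M: "binary_code n M" "U \<subseteq> M" "v \<notin> M" using M' by (auto simp: F_def)
  have max: "M = N" if "binary_code n N" "M \<subseteq> N" "v \<notin> N" for N
    using that M max' by (auto simp: F_def)
  have Mcarr: "M \<subseteq> carrier_vec n" and M0: "0\<^sub>v n \<in> M"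
    and Madd: "\<And>x y. x \<in> M \<Longrightarrow> y \<in> M \<Longrightarrow> x + y \<in> M"
    using M unfolding binary_code_iff by auto
  \<comment> \<open>The span of \<open>M\<close> and \<open>a\<close> is strictly larger than
    \<open>M\<close>, so by maximality it contains \<open>v\<close>. As \<open>v\<close> is not in
    \<open>M\<close>, it has the form \<open>m + a\<close>. Thus everything outside \<open>M\<close>
    lies in the single coset of \<open>v\<close>.\<close>
  have coset: "a + v \<in> M" if a: "a \<in> carrier_vec n" "a \<notin> M" for a
  proof -
    let ?N = "code_sum M {0\<^sub>v n, a}"
    have "binary_code n {0\<^sub>v n, a}"
      unfolding binary_code_iff using a by (auto simp: bit_vec_add_self)
    then have N: "binary_code n ?N" using M by (auto intro: binary_code_sum)
    have "m + 0\<^sub>v n = m" if "m \<in> M" for m using that Mcarr by auto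
    then have "M \<subseteq> ?N" unfolding code_sum_def by (auto, metis)
    moreover have "a = 0\<^sub>v n + a" using a by simp
    then have "a \<in> ?N" unfolding code_sum_def using M0 by blast
    ultimately have "v \<in> ?N" using max[OF N] a by blast
    then obtain m where m: "m \<in> M" "v = m + 0\<^sub>v n \<or> v = m + a"
      unfolding code_sum_def by blast
    moreover from m have "m + 0\<^sub>v n \<in> M" using Mcarr by auto
    ultimately have "v = m + a" using M by auto
    moreover have "m \<in> carrier_vec n" using m Mcarr by auto
    ultimately have "a + v = m" using a by (intro eq_vecI) (auto simp: algebra_simps)
    then show ?thesis using m by simp
  qed
  define f where "f w = (if w \<in> M then 0 else 1 :: bit)" for w
  have cancel: "b \<in> M" if "a \<in> M" "a + b \<in> M" "b \<in> carrier_vec n" for a b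
  proof -
    have "a \<in> carrier_vec n" using that Mcarr by auto
    then have "b = a + (a + b)" using that by (intro eq_vecI) (auto simp flip: add.assoc)
    then show ?thesis using that Madd by metis
  qed
  have cancel': "a \<in> M" if "b \<in> M" "a + b \<in> M" "a \<in> carrier_vec n" for a b
    using cancel[of b a] that Mcarr comm_add_vec[of a n b] by auto
  have "f (a + b) = f a + f b" if ab: "a \<in> carrier_vec n" "b \<in> carrier_vec n" for a b
  proof -
    have "a + b \<in> M" if "a \<notin> M" "b \<notin> M"
    proof -
      \<comment> \<open>The two copies of \<open>v\<close> cancel in characteristic two, which
        writes \<open>a + b\<close> as a sum of two elements of \<open>M\<close>.\<close>
      have "(a + v) + (b + v) = a + b"
        using ab v by (intro eq_vecI) (auto simp: algebra_simps)
      then show ?thesis using Madd[OF coset coset] ab that by metis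
    qed
    moreover have "a + b \<notin> M" if "a \<in> M" "b \<notin> M"
      using cancel[OF that(1) _ ab(2)] that by blast
    moreover have "a + b \<notin> M" if "a \<notin> M" "b \<in> M"
      using cancel'[OF that(2) _ ab(1)] that by blast
    ultimately show ?thesis
      using Madd[of a b] by (cases "a \<in> M"; cases "b \<in> M") (simp_all add: f_def)
  qed
  note f_add = this
  \<comment> \<open>The vector representing \<open>f\<close> as a scalar product must have the
    values of \<open>f\<close> on the unit vectors as entries.\<close>
  define x where "x = vec n (\<lambda>i. f (unit_vec n i))"
  have f: "x \<bullet> w = f w" if w: "w \<in> carrier_vec n" for w
  proof -
    have "x \<bullet> w = (\<Sum>i<n. w $ i * f (unit_vec n i))"
      unfolding x_def scalar_prod_def using w by (intro sum.cong) (auto simp: mult.commute)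
    also have "\<dots> = f w"
      by (rule additive_functional_expansion[of n f, OF f_add w, symmetric])
    finally show ?thesis .
  qed
  have xc: "x \<in> carrier_vec n" by (simp add: x_def)
  have "x \<bullet> y = 0" if "y \<in> U" for y
  proof -
    have "y \<in> M" using that M by auto
    moreover from this have "y \<in> carrier_vec n" using Mcarr by auto
    ultimately show ?thesis using f by (simp add: f_def)
  qed
  with xc have "x \<in> dual_code n U" by (simp add: dual_code_iff)
  moreover have "x \<bullet> v = 1" using f[OF v(1)] M by (simp add: f_def)
  ultimately show ?thesis by (rule that)
qed

text \<open>A vector outside the sum of \<open>C\<close> and its dual would be separated from that
  sum by some \<open>x\<close> orthogonal to both summands. Such an \<open>x\<close> lies in the
  dual and in the double dual, which is contained in \<open>C\<close>, so it is zero and separates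
  nothing.\<close>

lemma LCD_code_decomposition:
  assumes "LCD_code n C" and v: "v \<in> carrier_vec n"
  obtains c d where "c \<in> C" "d \<in> dual_code n C" "v = c + d"
proof -
  have C: "binary_code n C" and int: "C \<inter> dual_code n C = {0\<^sub>v n}"
    using assms unfolding LCD_code_def by auto
  have carr: "C \<subseteq> carrier_vec n" using C unfolding binary_code_iff by auto
  have D: "binary_code n (dual_code n C)" by (rule binary_code_dual[OF carr])
  have "v \<in> code_sum C (dual_code n C)"
  proof (rule ccontr)
    assume "v \<notin> code_sum C (dual_code n C)"
    then obtain x where x: "x \<in> dual_code n (code_sum C (dual_code n C))" "x \<bullet> v = 1"
      using dual_code_separation[OF binary_code_sum[OF C D] v] by blast
    then have xc: "x \<in> carrier_vec n" by (simp add: dual_code_iff)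
    have "c = c + 0\<^sub>v n" if "c \<in> C" for c using that carr by auto
    then have "C \<subseteq> code_sum C (dual_code n C)"
      using D unfolding binary_code_iff code_sum_def by blast
    then have xC: "x \<in> dual_code n C" using x by (auto simp: dual_code_iff)
    have "d = 0\<^sub>v n + d" if "d \<in> dual_code n C" for d using that by (auto simp: dual_code_iff)
    then have "dual_code n C \<subseteq> code_sum C (dual_code n C)"
      using C unfolding binary_code_iff code_sum_def by blast
    then have "x \<bullet> d = 0" if "d \<in> dual_code n C" for d
      using x(1) that unfolding dual_code_iff[of x] by blast
    moreover have "d \<bullet> x = x \<bullet> d" if "d \<in> dual_code n C" for d
      using xc that comm_scalar_prod by (auto simp: dual_code_iff)
    \<comment> \<open>Were \<open>x\<close> outside \<open>C\<close>, some \<open>d\<close> in the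
      dual would satisfy \<open>d \<bullet> x = 1\<close>.\<close>
    ultimately have "x \<in> C" using dual_code_separation[OF C xc] by fastforce
    then have "x = 0\<^sub>v n" using xC int by auto
    then show False using x v by simp
  qed
  then show ?thesis using that unfolding code_sum_def by blast
qed

section \<open>Orthogonal projectors\<close>

text \<open>The condition under the definite description in \<open>orthogonal_projector\<close>,
  isolated so that existence and uniqueness can be treated separately.\<close>

definition is_projector :: "nat \<Rightarrow> bit vec set \<Rightarrow> bit mat \<Rightarrow> bool" where
  "is_projector n C P \<longleftrightarrow> P \<in> carrier_mat n n
     \<and> (\<forall>v\<in>C. row_vec_mult v P = v) \<and> (\<forall>v\<in>dual_code n C. row_vec_mult v P = 0\<^sub>v n)"

lemma row_vec_mult_index:
  assumes "P \<in> carrier_mat n n" "v \<in> carrier_vec n" "j < n"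
  shows "row_vec_mult v P $ j = (\<Sum>i<n. v $ i * P $$ (i, j))"
proof -
  have "row_vec_mult v P $ j = v \<bullet> col P j" using assms by (simp add: row_vec_mult_def)
  also have "\<dots> = (\<Sum>i<n. v $ i * P $$ (i, j))"
    unfolding scalar_prod_def using assms by (intro sum.cong) auto
  finally show ?thesis .
qed

lemma row_vec_mult_add:
  assumes "P \<in> carrier_mat n n" "v \<in> carrier_vec n" "w \<in> carrier_vec n"
  shows "row_vec_mult (v + w) P = row_vec_mult v P + row_vec_mult w P"
  using assms unfolding row_vec_mult_def
  by (intro eq_vecI) (auto intro!: add_scalar_prod_distrib[of _ n])

lemma row_vec_mult_unit_vec:
  fixes P :: "'a::semiring_1 mat"
  assumes "P \<in> carrier_mat n n" "i < n"
  shows "row_vec_mult (unit_vec n i) P = row P i"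
  using assms unfolding row_vec_mult_def by (intro eq_vecI) auto

lemma is_projector_decomposition:
  assumes "is_projector n C P" "C \<subseteq> carrier_vec n" "c \<in> C" "d \<in> dual_code n C"
  shows "row_vec_mult (c + d) P = c"
proof -
  have "row_vec_mult (c + d) P = row_vec_mult c P + row_vec_mult d P"
    using assms by (intro row_vec_mult_add[of _ n]) (auto simp: is_projector_def dual_code_iff)
  also have "\<dots> = c + 0\<^sub>v n" using assms by (simp add: is_projector_def)
  finally show ?thesis using assms by auto
qed

text \<open>The rows of a matrix are the images of the unit vectors, and both matrices send a unit
  vector to its component in \<open>C\<close>.\<close>

lemma is_projector_unique:
  assumes C: "LCD_code n C" and P: "is_projector n C P" and Q: "is_projector n C Q"
  shows "P = Q"
proof (rule eq_rowI)
  have dims: "P \<in> carrier_mat n n" "Q \<in> carrier_mat n n"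
    using P Q by (auto simp: is_projector_def)
  then show "dim_row P = dim_row Q" "dim_col P = dim_col Q" by auto
  fix i assume "i < dim_row Q"
  then have i: "i < n" using dims by auto
  have "C \<subseteq> carrier_vec n" using C unfolding LCD_code_def binary_code_iff by auto
  moreover obtain c d where "c \<in> C" "d \<in> dual_code n C" "unit_vec n i = c + d"
    using LCD_code_decomposition[OF C, of "unit_vec n i"] by auto
  ultimately have "row_vec_mult (unit_vec n i) P = row_vec_mult (unit_vec n i) Q"
    using is_projector_decomposition[OF P] is_projector_decomposition[OF Q] by simp
  then show "row P i = row Q i"
    using row_vec_mult_unit_vec[OF dims(1) i] row_vec_mult_unit_vec[OF dims(2) i] by simp
qed

lemma orthogonal_projector_eqI:
  assumes "LCD_code n C" "is_projector n C P"
  shows "orthogonal_projector n C = P"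
proof -
  have "(THE Q. is_projector n C Q) = P"
    using assms(2) is_projector_unique[OF assms(1) _ assms(2)] by (rule the_equality)
  then show ?thesis by (simp only: orthogonal_projector_def is_projector_def)
qed

text \<open>Taking the component in \<open>C\<close> is a well-defined additive map, because
  \<open>C\<close> meets its dual only in zero. The projector is the matrix of this map.\<close>

lemma is_projector_exists:
  assumes LCD: "LCD_code n C"
  shows "\<exists>P. is_projector n C P"
proof -
  have C: "binary_code n C" and int: "C \<inter> dual_code n C = {0\<^sub>v n}"
    using LCD unfolding LCD_code_def by auto
  have carr: "C \<subseteq> carrier_vec n" and C0: "0\<^sub>v n \<in> C"
    and Cadd: "\<And>x y. x \<in> C \<Longrightarrow> y \<in> C \<Longrightarrow> x + y \<in> C"
    using C unfolding binary_code_iff by auto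
  have Dcarr: "dual_code n C \<subseteq> carrier_vec n" and D0: "0\<^sub>v n \<in> dual_code n C"
    and Dadd: "\<And>x y. x \<in> dual_code n C \<Longrightarrow> y \<in> dual_code n C \<Longrightarrow> x + y \<in> dual_code n C"
    using binary_code_dual[OF carr] unfolding binary_code_iff by auto
  have "\<forall>v\<in>carrier_vec n. \<exists>c. c \<in> C \<and> (\<exists>d\<in>dual_code n C. v = c + d)"
    using LCD_code_decomposition[OF LCD] by metis
  then obtain p where p: "\<And>v. v \<in> carrier_vec n \<Longrightarrow> p v \<in> C \<and> (\<exists>d\<in>dual_code n C. v = p v + d)"
    by metis
  have p_eqI: "p v = c" if "c \<in> C" "d \<in> dual_code n C" "v = c + d" for v c d
  proof -
    have v: "v \<in> carrier_vec n" using that carr Dcarr by (auto intro!: add_carrier_vec)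
    obtain d' where d': "d' \<in> dual_code n C" "v = p v + d'" "p v \<in> C" using p[OF v] by blast
    have carrs: "c \<in> carrier_vec n" "d \<in> carrier_vec n" "d' \<in> carrier_vec n" "p v \<in> carrier_vec n"
      using that d' carr Dcarr by auto
    \<comment> \<open>Adding the two decompositions of \<open>v\<close> gives zero, so
      \<open>p v + c\<close> and \<open>d' + d\<close> are the same vector, which lies in both
      \<open>C\<close> and its dual.\<close>
    have "(p v + c) + (d' + d) = (p v + d') + (c + d)"
      using carrs by (intro vec_add_interchange)
    also have "\<dots> = v + v" using d' \<open>v = c + d\<close> by simp
    also have "\<dots> = 0\<^sub>v n" by (rule bit_vec_add_self[OF v])
    finally have "p v + c = d' + d" by (rule bit_vec_add_eq_0D) (use carrs in auto)
    moreover have "p v + c \<in> C" "d' + d \<in> dual_code n C" using that d' Cadd Dadd by auto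
    ultimately have "p v + c = 0\<^sub>v n" using int by auto
    then show ?thesis by (rule bit_vec_add_eq_0D) (use carrs in auto)
  qed
  have p_add: "p (v + w) = p v + p w" if vw: "v \<in> carrier_vec n" "w \<in> carrier_vec n" for v w
  proof -
    obtain d where d: "p v \<in> C" "d \<in> dual_code n C" "v = p v + d" using p[OF vw(1)] by blast
    obtain e where e: "p w \<in> C" "e \<in> dual_code n C" "w = p w + e" using p[OF vw(2)] by blast
    have "(p v + d) + (p w + e) = (p v + p w) + (d + e)"
      by (rule vec_add_interchange[of _ n]) (use d(1,2) e(1,2) carr Dcarr in auto)
    then have "v + w = (p v + p w) + (d + e)" by (simp only: d(3)[symmetric] e(3)[symmetric])
    with Cadd[OF d(1) e(1)] Dadd[OF d(2) e(2)] show ?thesis by (rule p_eqI)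
  qed
  have p_carr: "p v \<in> carrier_vec n" if "v \<in> carrier_vec n" for v using p[OF that] carr by auto
  \<comment> \<open>Matrices act on row vectors from the right, so the image of each unit vector
    becomes a row.\<close>
  define P where "P = mat n n (\<lambda>(i, j). p (unit_vec n i) $ j)"
  have Pc: "P \<in> carrier_mat n n" by (simp add: P_def)
  have P: "row_vec_mult v P = p v" if v: "v \<in> carrier_vec n" for v
  proof (rule eq_vecI)
    show "dim_vec (row_vec_mult v P) = dim_vec (p v)"
      using p_carr[OF v] by (auto simp: row_vec_mult_def P_def)
    fix j assume "j < dim_vec (p v)"
    then have j: "j < n" using p_carr[OF v] by auto
    \<comment> \<open>The expansion lemma concerns functionals with values in the field, so it is
      applied to each coordinate of \<open>p\<close> separately.\<close>
    have "p (a + b) $ j = p a $ j + p b $ j" if "a \<in> carrier_vec n" "b \<in> carrier_vec n" for a b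
      using p_add[OF that] p_carr[OF that(1)] p_carr[OF that(2)] j by auto
    from additive_functional_expansion[of n "\<lambda>v. p v $ j", OF this v]
    have "p v $ j = (\<Sum>i<n. v $ i * p (unit_vec n i) $ j)" .
    moreover have "row_vec_mult v P $ j = (\<Sum>i<n. v $ i * p (unit_vec n i) $ j)"
      unfolding row_vec_mult_index[OF Pc v j] using j by (intro sum.cong) (auto simp: P_def)
    ultimately show "row_vec_mult v P $ j = p v $ j" by simp
  qed
  have "is_projector n C P"
    unfolding is_projector_def
  proof (intro conjI ballI)
    show "P \<in> carrier_mat n n" by (rule Pc)
    show "row_vec_mult v P = v" if "v \<in> C" for v
      using P[of v] p_eqI[OF that D0, of v] that carr by auto
    show "row_vec_mult v P = 0\<^sub>v n" if "v \<in> dual_code n C" for v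
      using P[of v] p_eqI[OF C0 that, of v] that Dcarr by auto
  qed
  then show ?thesis by blast
qed

lemma orthogonal_projector_is_projector:
  assumes "LCD_code n C"
  shows "is_projector n C (orthogonal_projector n C)"
  using is_projector_exists[OF assms] orthogonal_projector_eqI[OF assms] by auto

text \<open>Every row of the projector is the \<open>C\<close> component of a unit vector, hence a
  codeword, and the projector fixes codewords.\<close>

lemma orthogonal_projector_idempotent:
  assumes LCD: "LCD_code n C"
  shows "orthogonal_projector n C * orthogonal_projector n C = orthogonal_projector n C"
proof -
  define P where "P = orthogonal_projector n C"
  have proj: "is_projector n C P"
    unfolding P_def by (rule orthogonal_projector_is_projector[OF LCD])
  have P: "P \<in> carrier_mat n n" using proj by (simp add: is_projector_def)
  have carr: "C \<subseteq> carrier_vec n" using LCD unfolding LCD_code_def binary_code_iff by auto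
  have rows: "row P i \<in> C" if i: "i < n" for i
  proof -
    obtain c d where cd: "c \<in> C" "d \<in> dual_code n C" "unit_vec n i = c + d"
      using LCD_code_decomposition[OF LCD, of "unit_vec n i"] by auto
    then show ?thesis
      using is_projector_decomposition[OF proj carr cd(1,2)] row_vec_mult_unit_vec[OF P i] by simp
  qed
  have "P * P = P"
  proof (rule eq_matI)
    fix i j assume "i < dim_row P" "j < dim_col P"
    then have ij: "i < n" "j < n" using P by auto
    then have "(P * P) $$ (i, j) = row_vec_mult (row P i) P $ j"
      using P by (simp add: row_vec_mult_def)
    also have "row_vec_mult (row P i) P = row P i"
      using proj rows[OF ij(1)] by (simp add: is_projector_def)
    finally show "(P * P) $$ (i, j) = P $$ (i, j)" using P ij by simp
  qed (use P in auto)
  then show ?thesis by (simp add: P_def)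
qed

text \<open>An entry of the squared adjacency matrix counts walks of length two modulo 2. By
  idempotence this count is odd between adjacent vertices, so at least one such walk exists.\<close>

lemma yields_even_LCD_code_common_neighbour:
  assumes "yields_even_LCD_code G vs" and uv: "(u, v) \<in> parcs G"
  shows "\<exists>w\<in>pverts G. (u, w) \<in> parcs G \<and> (w, v) \<in> parcs G"
proof (rule ccontr)
  assume none: "\<not> ?thesis"
  have ord: "vertex_ordering G vs" and G: "pair_graph G"
    using assms by (auto simp: yields_even_LCD_code_def)
  interpret pair_graph G by (rule G)
  obtain C where C: "LCD_code (length vs) C"
      "adjacency_matrix G vs = orthogonal_projector (length vs) C"
    using assms by (auto simp: yields_even_LCD_code_def)
  define A where "A = (adjacency_matrix G vs :: bit mat)"
  have A: "A \<in> carrier_mat (length vs) (length vs)" by (simp add: A_def adjacency_matrix_def)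
  have idem: "A * A = A"
    using orthogonal_projector_idempotent[OF C(1)] C(2) by (simp add: A_def)
  have "u \<in> set vs" "v \<in> set vs"
    using uv ord wellformed[of "(u, v)"] by (auto simp: vertex_ordering_def)
  then have "\<exists>a<length vs. vs ! a = u" "\<exists>b<length vs. vs ! b = v"
    by (simp_all only: in_set_conv_nth)
  then obtain a b where ab: "a < length vs" "b < length vs" "vs ! a = u" "vs ! b = v"
    by blast
  have "A $$ (a, k) * A $$ (k, b) = 0" if "k < length vs" for k
  proof -
    have "vs ! k \<in> pverts G" using nth_mem[OF that] ord by (simp add: vertex_ordering_def)
    then have "(u, vs ! k) \<notin> parcs G \<or> (vs ! k, v) \<notin> parcs G" using none by blast
    then show ?thesis
    proof
      assume "(u, vs ! k) \<notin> parcs G"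
      then have "A $$ (a, k) = 0" using that ab by (simp add: A_def adjacency_matrix_def)
      then show ?thesis by simp
    next
      assume "(vs ! k, v) \<notin> parcs G"
      then have "A $$ (k, b) = 0" using that ab by (simp add: A_def adjacency_matrix_def)
      then show ?thesis by simp
    qed
  qed
  then have zero: "row A a $ k * col A b $ k = 0" if "k < length vs" for k
    using that A ab by simp
  have "(A * A) $$ (a, b) = row A a \<bullet> col A b" using A ab by simp
  also have "\<dots> = 0"
    unfolding scalar_prod_def using A zero by (intro sum.neutral) auto
  finally have "(A * A) $$ (a, b) = 0" .
  moreover have "A $$ (a, b) = 1" using ab uv by (simp add: A_def adjacency_matrix_def)
  ultimately show False using idem by simp
qed

section \<open>Complete graphs of odd order\<close>

text \<open>Turns the parity of the weight into a linear functional, so that evenness becomes a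
  linear condition.\<close>

lemma of_nat_hamming_weight:
  "(of_nat (hamming_weight v) :: bit) = (\<Sum>i<dim_vec v. v $ i)"
proof -
  have "(\<Sum>i<dim_vec v. v $ i) = (\<Sum>i<dim_vec v. if v $ i \<noteq> 0 then 1 else 0)"
    by (intro sum.cong) auto
  also have "\<dots> = (\<Sum>i\<in>{i. i < dim_vec v \<and> v $ i \<noteq> 0}. 1)"
    by (subst sum.inter_filter[symmetric]) (auto intro: sum.cong)
  finally show ?thesis by (simp add: hamming_weight_def)
qed

definition even_weight_code :: "nat \<Rightarrow> bit vec set" where
  "even_weight_code n = {v \<in> carrier_vec n. (\<Sum>i<n. v $ i) = 0}"

lemma even_code_even_weight_code: "even_code (even_weight_code n)"
  unfolding even_code_def
proof
  fix v assume "v \<in> even_weight_code n"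
  then have "(of_nat (hamming_weight v) :: bit) = 0"
    by (auto simp: of_nat_hamming_weight even_weight_code_def)
  then show "even (hamming_weight v)" by (metis even_of_nat even_zero)
qed

lemma binary_code_even_weight_code: "binary_code n (even_weight_code n)"
proof -
  have "(\<Sum>i<n. (x + y) $ i) = (\<Sum>i<n. x $ i) + (\<Sum>i<n. y $ i)"
    if "x \<in> carrier_vec n" "y \<in> carrier_vec n" for x y :: "bit vec"
    unfolding sum.distrib[symmetric] using that by (intro sum.cong) auto
  then show ?thesis
    unfolding binary_code_iff even_weight_code_def by auto
qed

lemma sum_bit_const: "(\<Sum>i<(n::nat). (c::bit)) = (if even n then 0 else c)"
  by (induction n) (simp_all del: sum_constant)

text \<open>Pairing \<open>x\<close> with the word of weight two supported on \<open>i\<close> and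
  \<open>j\<close> gives \<open>x $ i + x $ j = 0\<close>. The dual therefore consists of constant
  words.\<close>

lemma dual_even_weight_code_const:
  assumes x: "x \<in> dual_code n (even_weight_code n)" and ij: "i < n" "j < n"
  shows "x $ i = x $ j"
proof (cases "i = j")
  case False
  let ?y = "unit_vec n i + unit_vec n j :: bit vec"
  have "(\<Sum>k<n. ?y $ k) = (\<Sum>k<n. if k = i then 1 else 0) + (\<Sum>k<n. if k = j then 1 else 0)"
    unfolding sum.distrib[symmetric] using ij by (intro sum.cong) auto
  then have "?y \<in> even_weight_code n" using ij by (simp add: even_weight_code_def)
  then have "x \<bullet> ?y = 0" using x by (simp add: dual_code_iff)
  moreover have "x \<in> carrier_vec n" using x by (simp add: dual_code_iff)
  ultimately have "x $ i + x $ j = 0"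
    using ij by (simp add: scalar_prod_add_distrib[of _ n])
  then show ?thesis by (cases "x $ i"; cases "x $ j") auto
qed simp

text \<open>The word is constant, and an odd number of copies of a bit add up to that bit.\<close>

lemma dual_even_weight_code_sum:
  assumes x: "x \<in> dual_code n (even_weight_code n)" and i: "i < n" and "odd n"
  shows "(\<Sum>k<n. x $ k) = x $ i"
proof -
  have "(\<Sum>k<n. x $ k) = (\<Sum>k<n. x $ i)"
  proof (rule sum.cong[OF refl])
    fix k assume "k \<in> {..<n}"
    then have "k < n" by simp
    then show "x $ k = x $ i" by (rule dual_even_weight_code_const[OF x _ i])
  qed
  also have "\<dots> = x $ i" unfolding sum_bit_const using \<open>odd n\<close> by simp
  finally show ?thesis .
qed

text \<open>For a word in both codes the coordinate sum is zero and also equals every entry. In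
  positive even length this fails, as the all-ones word lies in both.\<close>

lemma LCD_even_weight_code:
  assumes "odd n"
  shows "LCD_code n (even_weight_code n)"
proof -
  let ?C = "even_weight_code n"
  have "x = 0\<^sub>v n" if x: "x \<in> ?C" "x \<in> dual_code n ?C" for x
  proof (rule eq_vecI)
    show "dim_vec x = dim_vec (0\<^sub>v n :: bit vec)" using x by (auto simp: even_weight_code_def)
    fix i assume "i < dim_vec (0\<^sub>v n :: bit vec)"
    then have i: "i < n" by simp
    have "(\<Sum>k<n. x $ k) = 0" using x(1) by (simp add: even_weight_code_def)
    then show "x $ i = 0\<^sub>v n $ i"
      using dual_even_weight_code_sum[OF x(2) i assms] i by simp
  qed
  moreover have "0\<^sub>v n \<in> ?C" "0\<^sub>v n \<in> dual_code n ?C"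
    by (auto simp: even_weight_code_def dual_code_iff)
  ultimately show ?thesis
    unfolding LCD_code_def using binary_code_even_weight_code by blast
qed

text \<open>The matrix is the all-ones matrix plus the identity, so it adds the coordinate sum of
  \<open>v\<close> to every entry of \<open>v\<close>. On the code this sum vanishes; on the dual it
  equals each entry and cancels it.\<close>

lemma is_projector_even_weight_code:
  assumes "odd n"
  shows "is_projector n (even_weight_code n) (mat n n (\<lambda>(i, j). if i \<noteq> j then 1 else 0))"
    (is "is_projector n ?C ?P")
proof -
  have mult: "row_vec_mult v ?P $ j = (\<Sum>i<n. v $ i) + v $ j"
    if v: "v \<in> carrier_vec n" and j: "j < n" for v j
  proof -
    have "row_vec_mult v ?P $ j = (\<Sum>i<n. v $ i * ?P $$ (i, j))"
      by (rule row_vec_mult_index[OF _ v j]) simp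
    \<comment> \<open>Omitting the term at \<open>j\<close> is the same as adding it a second
      time.\<close>
    also have "\<dots> = (\<Sum>i<n. v $ i + (if i = j then v $ i else 0))"
      using j by (intro sum.cong) auto
    also have "\<dots> = (\<Sum>i<n. v $ i) + v $ j" unfolding sum.distrib using j by simp
    finally show ?thesis .
  qed
  have dim: "dim_vec (row_vec_mult v ?P) = n" for v by (simp add: row_vec_mult_def)
  show ?thesis
    unfolding is_projector_def
  proof (intro conjI ballI)
    show "row_vec_mult v ?P = v" if "v \<in> ?C" for v
      using that by (intro eq_vecI) (auto simp: mult dim even_weight_code_def)
    show "row_vec_mult v ?P = 0\<^sub>v n" if v: "v \<in> dual_code n ?C" for v
    proof (rule eq_vecI)
      fix j assume "j < dim_vec (0\<^sub>v n :: bit vec)"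
      then have j: "j < n" by simp
      have "v \<in> carrier_vec n" using v by (simp add: dual_code_iff)
      then have "row_vec_mult v ?P $ j = (\<Sum>i<n. v $ i) + v $ j" by (rule mult[OF _ j])
      also have "\<dots> = v $ j + v $ j" using dual_even_weight_code_sum[OF v j assms] by simp
      finally show "row_vec_mult v ?P $ j = 0\<^sub>v n $ j" using j by simp
    qed (simp add: dim)
  qed simp
qed

text \<open>In any vertex ordering the adjacency matrix has zeros exactly on the diagonal, because
  the listed vertices are distinct. This is the projector of the even weight code.\<close>

lemma complete_graph_yields_even_LCD_code:
  assumes "odd n" and G: "complete_digraph n (with_proj G)" and vs: "vertex_ordering G vs"
  shows "yields_even_LCD_code G vs"
proof -
  have arcs: "parcs G = {(u, v). (u, v) \<in> pverts G \<times> pverts G \<and> u \<noteq> v}"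
    and card: "card (pverts G) = n"
    using G unfolding complete_digraph_pair_def by auto
  have len: "length vs = n"
    using vs card distinct_card by (force simp: vertex_ordering_def)
  have "adjacency_matrix G vs = (mat n n (\<lambda>(i, j). if i \<noteq> j then 1 else 0) :: bit mat)"
    using vs by (intro eq_matI)
      (auto simp: adjacency_matrix_def arcs len vertex_ordering_def nth_eq_iff_index_eq)
  then have "adjacency_matrix G vs = orthogonal_projector n (even_weight_code n)"
    using orthogonal_projector_eqI[OF LCD_even_weight_code is_projector_even_weight_code] assms(1)
    by simp
  then show ?thesis
    unfolding yields_even_LCD_code_def len
    using LCD_even_weight_code[OF assms(1)] even_code_even_weight_code
      pair_graphI_complete[OF G] vs by blast
qed

section \<open>Cycle graphs and the exceptional triangle\<close>

theorem proposition4p5: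
  fixes n :: nat and vs :: "nat list"
  assumes "n \<ge> 3" and "vertex_ordering (cycle_graph n) vs"
  shows "(yields_even_LCD_code (cycle_graph n) vs \<longleftrightarrow> n = 3)
    \<and> complete_digraph 3 (with_proj (cycle_graph 3))"
proof -
  \<comment> \<open>Two distinct residues modulo 3 always differ by one, which identifies the
    3-cycle with the complete graph.\<close>
  have "(j = Suc i mod 3 \<or> i = Suc j mod 3) \<longleftrightarrow> i \<noteq> j" if "i < 3" "j < 3" for i j :: nat
  proof -
    have "i = 0 \<or> i = 1 \<or> i = 2" "j = 0 \<or> j = 1 \<or> j = 2" using that by linarith+
    then show ?thesis by (elim disjE) simp_all
  qed
  then have "parcs (cycle_graph 3) = {(i, j). (i, j) \<in> {0..<3} \<times> {0..<3} \<and> i \<noteq> j}"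
    unfolding cycle_graph_def by auto
  then have K3: "complete_digraph 3 (with_proj (cycle_graph 3))"
    unfolding complete_digraph_pair_def by (simp add: cycle_graph_def)
  have "n = 3" if yields: "yields_even_LCD_code (cycle_graph n) vs"
  proof (rule ccontr)
    assume "n \<noteq> 3"
    then have n: "n \<ge> 4" using assms(1) by simp
    \<comment> \<open>The edge between 0 and 1 gives the contradiction: the neighbours of 0 are 1
      and \<open>n - 1\<close>, those of 1 are 0 and 2, and \<open>n - 1 = 2\<close> would force
      \<open>n = 3\<close>.\<close>
    then have small: "Suc 0 mod n = 1" "Suc 1 mod n = 2" by simp_all
    then have "(0, 1) \<in> parcs (cycle_graph n)" using n by (simp add: cycle_graph_def)
    from yields_even_LCD_code_common_neighbour[OF yields this]
    obtain w where "(0, w) \<in> parcs (cycle_graph n)" "(w, 1) \<in> parcs (cycle_graph n)"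
      by blast
    then have w: "w < n" "w = 1 \<or> 0 = Suc w mod n" "1 = Suc w mod n \<or> w = 2"
      using small by (simp_all add: cycle_graph_def)
    \<comment> \<open>The wrap-around occurs only at \<open>w = n - 1\<close>, the second neighbour
      of 0.\<close>
    have "Suc w mod n = (if Suc w = n then 0 else Suc w)"
      using w(1) by (simp add: mod_Suc)
    then show False using n w by (auto split: if_splits)
  qed
  then show ?thesis
    using K3 complete_graph_yields_even_LCD_code[OF _ K3] assms(2) by auto
qed

end
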